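(* Let $\mathcal D$ be a finite or countably infinite set with at least two elements, and let $X\subseteq\mathcal D^{\mathbb N}$ be a nonempty $1$-sided subshift whose shift map $T:X\to X$ is surjective. If $X$ (i.e. $T:X\to X$) satisfies topological transitivity (TT), then it satisfies Parry topological transitivity (PTT).
   Context: $\mathcal D^{\mathbb N}=\{.d_1d_2d_3\dots: d_j\in\mathcal D\}$ carries the product topology ($\mathcal D$ discrete) and the left shift $T(.d_1d_2d_3\dots)=.d_2d_3\dots$. A $1$-sided subshift is a closed subset $X\subseteq\mathcal D^{\mathbb N}$ with $T(X)\subseteq X$. TT: for some $x\in X$ the forward orbit $O^+(x)=\{T^n x:n\ge0\}$ is dense in $X$. PTT: for some $x\in X$ the backward orbit $O^-(x)=\{y\in X: x=T^n y\text{ for some }n\ge0\}$ is dense in $X$. *)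

theory Defs
  imports "HOL-Analysis.Analysis"
begin

(* Sequences are indexed from 0, so x 0 is the digit d_1 of x = .d_1 d_2 d_3 ... *)

definition sequence_topology :: "'a set \<Rightarrow> (nat \<Rightarrow> 'a) topology" where
  "sequence_topology D = product_topology (\<lambda>_. discrete_topology D) UNIV"

definition left_shift :: "(nat \<Rightarrow> 'a) \<Rightarrow> (nat \<Rightarrow> 'a)" where
  "left_shift x = (\<lambda>n. x (Suc n))"

definition one_sided_subshift :: "'a set \<Rightarrow> (nat \<Rightarrow> 'a) set \<Rightarrow> bool" where
  "one_sided_subshift D X \<longleftrightarrow>
     closedin (sequence_topology D) X \<and> left_shift ` X \<subseteq> X"

definition forward_orbit :: "('b \<Rightarrow> 'b) \<Rightarrow> 'b \<Rightarrow> 'b set" where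
  "forward_orbit T x = {(T ^^ n) x | n. True}"

definition backward_orbit :: "('b \<Rightarrow> 'b) \<Rightarrow> 'b set \<Rightarrow> 'b \<Rightarrow> 'b set" where
  "backward_orbit T X x = {y \<in> X. \<exists>n. x = (T ^^ n) y}"

definition dense_subset :: "'b topology \<Rightarrow> 'b set \<Rightarrow> bool" where
  "dense_subset \<tau> S \<longleftrightarrow> S \<subseteq> topspace \<tau> \<and> \<tau> closure_of S = topspace \<tau>"

definition TT :: "'b topology \<Rightarrow> ('b \<Rightarrow> 'b) \<Rightarrow> bool" where
  "TT \<tau> T \<longleftrightarrow> (\<exists>x \<in> topspace \<tau>. dense_subset \<tau> (forward_orbit T x))"

definition PTT :: "'b topology \<Rightarrow> ('b \<Rightarrow> 'b) \<Rightarrow> bool" where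
  "PTT \<tau> T \<longleftrightarrow> (\<exists>x \<in> topspace \<tau>. dense_subset \<tau> (backward_orbit T (topspace \<tau>) x))"

end

theory Submission
  imports Defs
begin

text \<open>
  Let \<open>x\<close> have a dense forward orbit. Since \<open>x\<close> has a preimage in \<open>X\<close>, which is approximated by
  the orbit, \<open>x\<close> is recurrent: every prefix of \<open>x\<close> reappears at some positive position. Hence there
  are shifts \<open>Q\<^sub>0 = 0 < Q\<^sub>1 < \<dots>\<close> such that \<open>x\<close> moved by \<open>Q\<^sub>k\<^sub>+\<^sub>1 - Q\<^sub>k\<close> agrees with \<open>x\<close> on its first
  \<open>Q\<^sub>k + k\<close> digits. The sequences \<open>y\<^sub>k = lim\<^sub>j T\<^bsup>Q\<^sub>j - Q\<^sub>k\<^esup> x\<close> then exist, satisfy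
  \<open>T\<^bsup>Q\<^sub>k\<^esup> y\<^sub>k = y\<^sub>0\<close>, and agree with \<open>x\<close> on longer and longer prefixes. So the points \<open>T\<^sup>p y\<^sub>k\<close>
  with \<open>p \<le> Q\<^sub>k\<close>, which lie in the backward orbit of \<open>y\<^sub>0\<close>, accumulate at every point \<open>T\<^sup>p x\<close>.
\<close>

lemma left_shift_funpow: "(left_shift ^^ n) x = (\<lambda>i. x (i + n))"
  by (induction n arbitrary: x) (auto simp: left_shift_def)

lemma topspace_sequence_topology: "topspace (sequence_topology D) = {x. range x \<subseteq> D}"
  by (auto simp: sequence_topology_def)

lemma openin_cylinder:
  assumes "range t \<subseteq> D"
  shows "openin (sequence_topology D) {s. range s \<subseteq> D \<and> (\<forall>n<N. s n = t n)}"
proof -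
  let ?U = "\<lambda>n. if n < N then {t n} else D"
  have "openin (sequence_topology D) (PiE UNIV ?U)"
    unfolding sequence_topology_def
  proof (rule product_topology_basis)
    show "openin (discrete_topology D) (?U n)" for n
      using assms by auto
    have "{n. ?U n \<noteq> topspace (discrete_topology D)} \<subseteq> {..<N}"
      by auto
    then show "finite {n. ?U n \<noteq> topspace (discrete_topology D)}"
      using finite_subset by blast
  qed
  moreover have "PiE UNIV ?U = {s. range s \<subseteq> D \<and> (\<forall>n<N. s n = t n)}"
    using assms by (auto simp: PiE_iff split: if_splits) (metis rangeI subsetD)
  ultimately show ?thesis
    by simp
qed

text \<open>Cylinders form a neighbourhood basis: a basic open box restricts only finitely many
  coordinates, so it contains a cylinder around each of its points. Closure thus becomes
  approximation on prefixes.\<close>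

lemma in_closure_of_sequence_topology:
  assumes S: "S \<subseteq> {x. range x \<subseteq> D}"
  shows "t \<in> sequence_topology D closure_of S \<longleftrightarrow>
    range t \<subseteq> D \<and> (\<forall>N. \<exists>s\<in>S. \<forall>n<N. s n = t n)" (is "?L \<longleftrightarrow> ?R")
proof
  assume L: ?L
  then have t: "range t \<subseteq> D"
    by (auto simp: in_closure_of topspace_sequence_topology)
  moreover have "\<exists>s\<in>S. \<forall>n<N. s n = t n" for N
  proof -
    define U where "U = {s. range s \<subseteq> D \<and> (\<forall>n<N. s n = t n)}"
    have "t \<in> U"
      using t by (simp add: U_def)
    moreover have "openin (sequence_topology D) U"
      unfolding U_def using t by (rule openin_cylinder)
    ultimately obtain s where "s \<in> S" "s \<in> U"
      using L unfolding in_closure_of by blast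
    then show ?thesis
      by (auto simp: U_def)
  qed
  ultimately show ?R
    by blast
next
  assume R: ?R
  have "\<exists>s\<in>S. s \<in> U" if tU: "t \<in> U" and U: "openin (sequence_topology D) U" for U
  proof -
    obtain V where V: "finite {n. V n \<noteq> D}" "t \<in> PiE UNIV V" "PiE UNIV V \<subseteq> U"
      using product_topology_open_contains_basis[OF U[unfolded sequence_topology_def] tU] by auto
    \<comment> \<open>\<open>N\<close> lies beyond every restricted coordinate; from there on
      \<open>V n = D\<close>, and \<open>s n \<in> V n\<close> only says that \<open>s\<close> takes
      values in \<open>D\<close>.\<close>
    obtain N where N: "\<And>n. V n \<noteq> D \<Longrightarrow> n < N"
      using finite_nat_set_iff_bounded V(1) by auto
    obtain s where s: "s \<in> S" "\<forall>n<N. s n = t n"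
      using R by blast
    have "s n \<in> V n" for n
    proof (cases "n < N")
      case True
      then show ?thesis
        using V(2) s(2) by auto
    next
      case False
      then show ?thesis
        using N s(1) S by blast
    qed
    then have "s \<in> PiE UNIV V"
      by auto
    then show ?thesis
      using V(3) s(1) by blast
  qed
  moreover have "t \<in> topspace (sequence_topology D)"
    using R by (simp add: topspace_sequence_topology)
  ultimately show ?L
    unfolding in_closure_of by blast
qed

lemma dense_subset_subshift_iff:
  assumes "X \<subseteq> {x. range x \<subseteq> D}"
  shows "dense_subset (subtopology (sequence_topology D) X) S \<longleftrightarrow>
    S \<subseteq> X \<and> (\<forall>t\<in>X. \<forall>N. \<exists>s\<in>S. \<forall>n<N. s n = t n)"
proof (cases "S \<subseteq> X")
  case True
  have top: "topspace (subtopology (sequence_topology D) X) = X"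
    using assms by (auto simp: topspace_sequence_topology)
  have "subtopology (sequence_topology D) X closure_of S = X \<inter> sequence_topology D closure_of S"
    using True by (simp add: closure_of_subtopology inf.absorb2)
  then have "dense_subset (subtopology (sequence_topology D) X) S \<longleftrightarrow>
      (\<forall>t\<in>X. t \<in> sequence_topology D closure_of S)"
    using True unfolding dense_subset_def top by auto
  moreover have "t \<in> sequence_topology D closure_of S \<longleftrightarrow> (\<forall>N. \<exists>s\<in>S. \<forall>n<N. s n = t n)"
    if "t \<in> X" for t
    using in_closure_of_sequence_topology[of S D t] True assms that by auto
  ultimately show ?thesis
    using True by simp
next
  case False
  then show ?thesis
    using assms by (auto simp: dense_subset_def)
qed

text \<open>Each gap \<open>Q (Suc k) - Q k\<close> is a return time for the prefix of length
  \<open>Q k + k\<close>. The summand \<open>k\<close> lets the agreement reach past position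
  \<open>Q k\<close>, where the digits of the common image \<open>y 0\<close> are read off.\<close>

lemma recurrent_return_times:
  fixes x :: "nat \<Rightarrow> 'a"
  assumes rec: "\<And>m. \<exists>q>0. \<forall>i<m. x (i + q) = x i"
  obtains Q :: "nat \<Rightarrow> nat" where "Q 0 = 0" "strict_mono Q"
    "\<And>k i. i < Q k + k \<Longrightarrow> x (i + (Q (Suc k) - Q k)) = x i"
proof -
  have "\<exists>Q. \<forall>k. (k = 0 \<longrightarrow> Q k = (0::nat)) \<and>
      (Q k < Q (Suc k) \<and> (\<forall>i < Q k + k. x (i + (Q (Suc k) - Q k)) = x i))"
  proof (intro dependent_nat_choice)
    fix a k :: nat
    obtain q where "q > 0" "\<forall>i < a + k. x (i + q) = x i"
      using rec by blast
    then have "a < a + q \<and> (\<forall>i < a + k. x (i + (a + q - a)) = x i)"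
      by simp
    then show "\<exists>b. (Suc k = 0 \<longrightarrow> b = 0) \<and> a < b \<and> (\<forall>i < a + k. x (i + (b - a)) = x i)"
      by blast
  qed auto
  then show ?thesis
    using that strict_monoI_Suc by metis
qed

lemma recurrent_backward_limits:
  fixes x :: "nat \<Rightarrow> 'a"
  assumes "\<And>m. \<exists>q>0. \<forall>i<m. x (i + q) = x i"
  obtains Q :: "nat \<Rightarrow> nat" and y :: "nat \<Rightarrow> nat \<Rightarrow> 'a"
  where "\<And>k. k \<le> Q k"
    "\<And>k j n. k \<le> j \<Longrightarrow> n < j \<Longrightarrow> y k n = x (n + (Q j - Q k))"
    "\<And>k n. y k (n + Q k) = y 0 n"
    "\<And>k n. n < k \<Longrightarrow> y k n = x n"
proof -
  obtain Q where Q0: "Q 0 = 0" and mono: "strict_mono Q"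
    and ret: "\<And>k i. i < Q k + k \<Longrightarrow> x (i + (Q (Suc k) - Q k)) = x i"
    using recurrent_return_times[OF assms] by metis
  have le: "Q k \<le> Q j" if "k \<le> j" for k j
    using mono that by (simp add: strict_mono_less_eq)
  \<comment> \<open>Going from \<open>Q j\<close> to \<open>Q (Suc j)\<close> moves the position
    being read by one return gap. That position is below \<open>Q j + j\<close>, so the digit
    persists.\<close>
  have stable: "x (n + (Q j - Q k)) = x (n + (Q i - Q k))"
    if "k \<le> i" "i \<le> j" "n < i + Q k" for i j k n
    using that(2)
  proof (induction j rule: dec_induct)
    case (step j)
    have "n + (Q (Suc j) - Q k) = (n + (Q j - Q k)) + (Q (Suc j) - Q j)"
      using le[of k j] le[of j "Suc j"] step that by simp
    moreover have "n + (Q j - Q k) < Q j + j"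
      using le[of k j] step that by simp
    ultimately show ?case
      using ret step.IH by metis
  qed simp
  \<comment> \<open>At index \<open>k + Suc n\<close> digit \<open>n\<close> has already stabilised,
    so this value is the limit.\<close>
  define y where "y k n = x (n + (Q (k + Suc n) - Q k))" for k n
  have y: "y k n = x (n + (Q j - Q k))" if "k \<le> j" "n < j + Q k" for k j n
    using stable[of k "k + Suc n" "max j (k + Suc n)" n] stable[of k j "max j (k + Suc n)" n] that
    unfolding y_def by simp
  show ?thesis
  proof (rule that)
    show "k \<le> Q k" for k
      using mono by (rule strict_mono_imp_increasing)
    show "y k n = x (n + (Q j - Q k))" if "k \<le> j" "n < j" for k j n
      using y that by simp
    show "y k (n + Q k) = y 0 n" for k n
      \<comment> \<open>For \<open>j = k + Suc n\<close> both sides equal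
        \<open>x (n + Q j)\<close>; the left one uses the full range \<open>n < j + Q k\<close> of
        \<open>y\<close>.\<close>
      using y[of k "k + Suc n" "n + Q k"] y[of 0 "k + Suc n" n] le[of k "k + Suc n"] Q0
      by (simp add: add.assoc)
    show "y k n = x n" if "n < k" for k n
      using y[of k k n] that by simp
  qed
qed

theorem corollary7:
  fixes D :: "'a set" and X :: "(nat \<Rightarrow> 'a) set"
  assumes "countable D"
    and "\<exists>a\<in>D. \<exists>b\<in>D. a \<noteq> b"
    and "one_sided_subshift D X"
    and "X \<noteq> {}"
    and "left_shift ` X = X"
    and "TT (subtopology (sequence_topology D) X) left_shift"
  shows "PTT (subtopology (sequence_topology D) X) left_shift"
proof -
  have closed: "closedin (sequence_topology D) X"
    using assms(3) by (simp add: one_sided_subshift_def)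
  then have XD: "X \<subseteq> {x. range x \<subseteq> D}"
    using closedin_subset topspace_sequence_topology by metis
  then have top: "topspace (subtopology (sequence_topology D) X) = X"
    by (auto simp: topspace_sequence_topology)
  have shift: "(\<lambda>i. u (i + n)) \<in> X" if "u \<in> X" for u n
  proof -
    have "(left_shift ^^ n) u \<in> X"
      using that assms(5) by (induction n) auto
    then show ?thesis
      by (simp add: left_shift_funpow)
  qed
  \<comment> \<open>Closedness of \<open>X\<close> in prefix form; that \<open>u\<close> takes
    values in \<open>D\<close> is read off digit by digit from the approximants.\<close>
  have limit: "u \<in> X" if approx: "\<And>N. \<exists>s\<in>X. \<forall>n<N. s n = u n" for u
  proof -
    have "u n \<in> D" for n
    proof -
      obtain s where "s \<in> X" "s n = u n"
        using approx[of "Suc n"] by blast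
      then show ?thesis
        using XD by (metis mem_Collect_eq rangeI subsetD)
    qed
    then have "u \<in> sequence_topology D closure_of X"
      unfolding in_closure_of_sequence_topology[OF XD] using approx by blast
    then show ?thesis
      by (simp add: closure_of_closedin[OF closed])
  qed

  obtain x where x: "x \<in> X"
    and dense: "\<And>t N. t \<in> X \<Longrightarrow> \<exists>p. \<forall>n<N. x (n + p) = t n"
  proof -
    obtain x where x: "x \<in> X"
      and "\<forall>t\<in>X. \<forall>N. \<exists>s\<in>forward_orbit left_shift x. \<forall>n<N. s n = t n"
      using assms(6) unfolding TT_def top dense_subset_subshift_iff[OF XD] by blast
    then have "\<exists>s\<in>range (\<lambda>p i. x (i + p)). \<forall>n<N. s n = t n" if "t \<in> X" for t N
      using that by (simp add: forward_orbit_def left_shift_funpow full_SetCompr_eq)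
    then have "\<exists>p. \<forall>n<N. x (n + p) = t n" if "t \<in> X" for t N
      using that by (simp only: bex_simps)
    with x show thesis
      by (rule that)
  qed
  have "\<exists>q>0. \<forall>i<m. x (i + q) = x i" for m
  proof -
    \<comment> \<open>Surjectivity enters here. An occurrence of a prefix of the preimage
      \<open>w\<close> at \<open>p\<close> gives one of \<open>x\<close> at \<open>Suc p\<close>,
      which is positive even if \<open>p = 0\<close>.\<close>
    obtain w where w: "w \<in> X" "x = left_shift w"
      using x assms(5) by blast
    obtain p where "\<forall>n<Suc m. x (n + p) = w n"
      using dense w(1) by blast
    then have "\<forall>i<m. x (i + Suc p) = x i"
      using w(2) by (auto simp: left_shift_def)
    then show ?thesis
      by blast
  qed
  then obtain Q y where Q: "\<And>k. k \<le> Q k"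
    and y_lim: "\<And>k j n. k \<le> j \<Longrightarrow> n < j \<Longrightarrow> y k n = x (n + (Q j - Q k))"
    and y_shift: "\<And>k n. y k (n + Q k) = y 0 n"
    and y_x: "\<And>k n. n < k \<Longrightarrow> y k n = x n"
    using recurrent_backward_limits[of x] by metis
  have yX: "y k \<in> X" for k
  proof (rule limit)
    fix N
    show "\<exists>s\<in>X. \<forall>n<N. s n = y k n"
      using shift[OF x, of "Q (max k N) - Q k"] y_lim[of k "max k N"] by force
  qed
  let ?B = "backward_orbit left_shift X (y 0)"
  have "\<exists>s\<in>?B. \<forall>n<N. s n = t n" if "t \<in> X" for t N
  proof -
    obtain p where p: "\<forall>n<N. x (n + p) = t n"
      using dense[OF \<open>t \<in> X\<close>] by blast
    \<comment> \<open>This \<open>k\<close> makes \<open>y k\<close> agree with \<open>x\<close> on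
      the window from \<open>p\<close> to \<open>p + N\<close>, and ensures
      \<open>p \<le> Q k\<close>, so that \<open>y k\<close> shifted by \<open>p\<close> still
      reaches \<open>y 0\<close> after \<open>Q k - p\<close> steps.\<close>
    define k where "k = N + p"
    have "p \<le> Q k"
      using Q[of k] by (simp add: k_def)
    then have "(left_shift ^^ (Q k - p)) (\<lambda>i. y k (i + p)) = y 0"
      by (simp add: left_shift_funpow add.assoc y_shift)
    then have "(\<lambda>i. y k (i + p)) \<in> ?B"
      using shift[OF yX] unfolding backward_orbit_def by (auto intro!: exI[of _ "Q k - p"])
    moreover have "\<forall>n<N. y k (n + p) = t n"
      using p y_x by (simp add: k_def)
    ultimately show ?thesis
      by (intro bexI[where x = "\<lambda>i. y k (i + p)"])
  qed
  moreover have "?B \<subseteq> X"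
    by (auto simp: backward_orbit_def)
  ultimately show ?thesis
    using yX unfolding PTT_def top dense_subset_subshift_iff[OF XD] by blast
qed

end
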